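(* Let $1\le p\le n$, let $K(n,p)=\{\alpha\in\mathcal{LS}_n:|\mathrm{Im}\,\alpha|\le p\}$ and $J^*_p=\{\alpha\in\mathcal{LS}_n:|\mathrm{Im}\,\alpha|=p\}$. Then $$\mathrm{rank}\,K(n,p)=\mathrm{idrank}\,K(n,p)=|E(J^*_p)|=\sum_{r=p}^{n}\binom{n}{r}\binom{r-1}{p-1}.$$
   Context: Let $[n]=\{1,2,\ldots,n\}$ with its usual order. A partial transformation of $[n]$ is a map $\alpha$ whose domain $\mathrm{Dom}\,\alpha$ and image $\mathrm{Im}\,\alpha$ are subsets of $[n]$ (the empty map is allowed); maps are written on the right and composed left to right: $x(\alpha\beta)=(x\alpha)\beta$. $\alpha$ is isotone if $x\le y$ implies $x\alpha\le y\alpha$ for all $x,y\in\mathrm{Dom}\,\alpha$, and order-decreasing if $x\alpha\le x$ for all $x\in\mathrm{Dom}\,\alpha$. $\mathcal{LS}_n$ is the semigroup of all isotone order-decreasing partial transformations of $[n]$; $K(n,p)$ is a two-sided ideal of it. $E(J^*_p)$ is the set of idempotents in $J^*_p$. For a finite semigroup $S$, $\mathrm{rank}(S)$ is the minimum cardinality of a subset $A\subseteq S$ with $\langle A\rangle=S$ (subsemigroup generated by $A$), and $\mathrm{idrank}(S)$ is the minimum cardinality of such an $A$ consisting of idempotents.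
   Formalization: The equality of rank and idrank with |E(J*_p)| is asserted only for p < n, since for p = n it fails (J*_n = {id} but K(n,n) also contains the empty map, e.g. rank K(1,1) = 2); rank = idrank and |E(J*_p)| = the sum are kept for all 1 ≤ p ≤ n. *)

theory Defs
  imports Complex_Main "HOL-Library.Extended_Nat"
begin

inductive_set sgen :: "('a \<Rightarrow> 'a \<Rightarrow> 'a) \<Rightarrow> 'a set \<Rightarrow> 'a set"
  for f :: "'a \<Rightarrow> 'a \<Rightarrow> 'a" and A :: "'a set" where
  base: "a \<in> A \<Longrightarrow> a \<in> sgen f A"
| mult: "x \<in> sgen f A \<Longrightarrow> y \<in> sgen f A \<Longrightarrow> f x y \<in> sgen f A"

definition idempotents :: "('a \<Rightarrow> 'a \<Rightarrow> 'a) \<Rightarrow> 'a set \<Rightarrow> 'a set" where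
  "idempotents f S = {e \<in> S. f e e = e}"

text \<open>Minima are taken in the extended naturals, so that the value is infinite when no finite
  generating set of the required kind exists.\<close>

definition srank :: "('a \<Rightarrow> 'a \<Rightarrow> 'a) \<Rightarrow> 'a set \<Rightarrow> enat" where
  "srank f S = (INF A \<in> {A. A \<subseteq> S \<and> finite A \<and> sgen f A = S}. enat (card A))"

definition idrank :: "('a \<Rightarrow> 'a \<Rightarrow> 'a) \<Rightarrow> 'a set \<Rightarrow> enat" where
  "idrank f S =
     (INF A \<in> {A. A \<subseteq> idempotents f S \<and> finite A \<and> sgen f A = S}. enat (card A))"

text \<open>Maps act on the right and compose from left to right: first \<open>\<alpha>\<close>, then \<open>\<beta>\<close>.\<close>

definition pcomp :: "(nat \<rightharpoonup> nat) \<Rightarrow> (nat \<rightharpoonup> nat) \<Rightarrow> (nat \<rightharpoonup> nat)" where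
  "pcomp \<alpha> \<beta> = \<beta> \<circ>\<^sub>m \<alpha>"

definition isotone :: "(nat \<rightharpoonup> nat) \<Rightarrow> bool" where
  "isotone \<alpha> \<longleftrightarrow> (\<forall>x\<in>dom \<alpha>. \<forall>y\<in>dom \<alpha>. x \<le> y \<longrightarrow> the (\<alpha> x) \<le> the (\<alpha> y))"

definition order_decreasing :: "(nat \<rightharpoonup> nat) \<Rightarrow> bool" where
  "order_decreasing \<alpha> \<longleftrightarrow> (\<forall>x\<in>dom \<alpha>. the (\<alpha> x) \<le> x)"

definition LS :: "nat \<Rightarrow> (nat \<rightharpoonup> nat) set" where
  "LS n = {\<alpha>. dom \<alpha> \<subseteq> {1..n} \<and> ran \<alpha> \<subseteq> {1..n} \<and> isotone \<alpha> \<and> order_decreasing \<alpha>}"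

definition K :: "nat \<Rightarrow> nat \<Rightarrow> (nat \<rightharpoonup> nat) set" where
  "K n p = {\<alpha> \<in> LS n. card (ran \<alpha>) \<le> p}"

definition Jstar :: "nat \<Rightarrow> nat \<Rightarrow> (nat \<rightharpoonup> nat) set" where
  "Jstar n p = {\<alpha> \<in> LS n. card (ran \<alpha>) = p}"

text \<open>For \<open>p = n\<close> the only element of \<open>Jstar n n\<close> is the identity of \<open>{1..n}\<close>, which generates
  nothing but itself, so the rank of \<open>K n n = LS n\<close> is never the number of idempotents of
  \<open>Jstar n n\<close>: that equality can only be asserted for \<open>p < n\<close>.\<close>

lemma idempotents_Jstar_top:
  "idempotents pcomp (Jstar n n) = {\<lambda>x. if x \<in> {1..n} then Some x else None}" (is "_ = {?i}")
proof (intro equalityI subsetI)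
  fix e assume "e \<in> idempotents pcomp (Jstar n n)"
  then have e: "e \<in> LS n" "card (ran e) = n" and idem: "pcomp e e = e"
    by (auto simp: idempotents_def Jstar_def)
  have dom: "dom e \<subseteq> {1..n}" and "ran e \<subseteq> {1..n}"
    using e(1) by (auto simp: LS_def)
  then have ran: "ran e = {1..n}"
    using e(2) by (intro card_subset_eq) auto
  have "e x = ?i x" for x
  proof (cases "x \<in> {1..n}")
    case True
    then have "x \<in> ran e" using ran by simp
    then obtain z where z: "e z = Some x"
      by (auto simp: ran_def)
    have "pcomp e e z = e z" by (simp add: idem)
    then show ?thesis using z True by (simp add: pcomp_def)
  next
    case False
    then show ?thesis using dom by (auto simp: dom_def)
  qed
  then show "e \<in> {?i}" by auto
next
  fix e assume "e \<in> {?i}"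
  moreover have dom: "dom ?i = {1..n}"
    by (auto simp: dom_def)
  moreover have "ran ?i = {1..n}"
  proof (intro equalityI subsetI)
    fix x assume "x \<in> {1..n}"
    then have "?i x = Some x" by simp
    then show "x \<in> ran ?i" by (rule ranI)
  qed (simp add: ran_def split: if_splits)
  moreover have "isotone ?i" "order_decreasing ?i"
    unfolding isotone_def order_decreasing_def dom by simp_all
  moreover have "pcomp ?i ?i = ?i"
    by (rule ext) (simp add: pcomp_def map_comp_def)
  ultimately show "e \<in> idempotents pcomp (Jstar n n)"
    by (simp add: idempotents_def Jstar_def LS_def)
qed

lemma enat_INF_attained:
  assumes "(INF A \<in> G. enat (c A)) = enat k"
  obtains A where "A \<in> G" "c A = k"
proof -
  let ?S = "(\<lambda>A. enat (c A)) ` G"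
  have "?S \<noteq> {}"
    using assms by (auto simp: Inf_enat_def)
  then have "Inf ?S \<in> ?S"
    unfolding Inf_enat_def by (metis LeastI ex_in_conv)
  then show thesis
    using that unfolding assms by blast
qed

lemma srank_top_neq:
  assumes "n \<ge> 1"
  shows "srank pcomp (K n n) \<noteq> enat (card (idempotents pcomp (Jstar n n)))"
proof
  let ?i = "\<lambda>x. if x \<in> {1..n} then Some x else None"
  assume "srank pcomp (K n n) = enat (card (idempotents pcomp (Jstar n n)))"
  then have "srank pcomp (K n n) = enat (card {?i})"
    by (simp only: idempotents_Jstar_top)
  then obtain A where "A \<in> {A. A \<subseteq> K n n \<and> finite A \<and> sgen pcomp A = K n n}"
      and "card A = card {?i}"
    unfolding srank_def by (rule enat_INF_attained)
  then have A: "A \<subseteq> K n n" "sgen pcomp A = K n n" "card A = 1"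
    by simp_all
  then obtain a where a: "A = {a}" by (auto simp: card_1_singleton_iff)
  have "?i \<in> idempotents pcomp (Jstar n n)" by (simp add: idempotents_Jstar_top)
  then have iK: "?i \<in> sgen pcomp {a}"
    using A a by (auto simp: idempotents_def Jstar_def K_def)
  have eK: "Map.empty \<in> sgen pcomp {a}"
    using A a by (auto simp: K_def LS_def isotone_def order_decreasing_def)
  have aK: "ran a \<subseteq> {1..n}" using A a by (auto simp: K_def LS_def)
  have sub: "dom z \<subseteq> dom a" if "z \<in> sgen pcomp {a}" for z
    using that by induction (auto simp: pcomp_def map_comp_def dom_def split: option.splits)
  have tot: "{1..n} \<subseteq> dom a" using sub[OF iK] by (auto simp: dom_def split: if_splits)
  have "{1..n} \<subseteq> dom z \<and> ran z \<subseteq> {1..n}" if "z \<in> sgen pcomp {a}" for z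
    using that
  proof induction
    case (base b)
    then show ?case using tot aK by auto
  next
    case (mult x y)
    have "t \<in> dom (pcomp x y)" if t: "t \<in> {1..n}" for t
    proof -
      obtain u where u: "x t = Some u" using mult t by blast
      then have "u \<in> {1..n}" using mult by (auto simp: ran_def)
      then obtain w where "y u = Some w" using mult by blast
      with u show ?thesis by (simp add: pcomp_def dom_def)
    qed
    moreover have "ran (pcomp x y) \<subseteq> ran y"
      by (auto simp: pcomp_def map_comp_def ran_def split: option.splits)
    ultimately show ?case using mult by blast
  qed
  from this[OF eK] assms show False by simp
qed

end

theory Submission
  imports Defs
begin

text \<open>If an idempotent \<open>e\<close> of rank \<open>q\<close> factors as \<open>e = x s\<close> with \<open>x\<close> of rank at most \<open>q\<close>, then the
  order-decreasing maps \<open>x\<close> and \<open>s\<close> fix the image of \<open>e\<close> pointwise, which forces \<open>x = e\<close>; so every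
  generating set of \<open>K n p\<close> contains all idempotents of rank \<open>p\<close>. Conversely these generate \<open>K n p\<close>
  for \<open>p < n\<close>: a map of rank \<open>p\<close> collapses its blocks to their minima, which are then moved one at a
  time to their images, and an idempotent of rank \<open>r \<le> n - 2\<close> is a product of two maps of rank
  \<open>r + 1\<close>. For \<open>p = n\<close> the idempotents of rank \<open>n - 1\<close> together with the identity form the least
  generating set.\<close>

section \<open>Generated subsemigroups and least generating sets\<close>

lemma sgen_least:
  assumes "A \<subseteq> T" and "\<And>x y. x \<in> T \<Longrightarrow> y \<in> T \<Longrightarrow> f x y \<in> T"
  shows "sgen f A \<subseteq> T"
proof
  fix x assume "x \<in> sgen f A"
  then show "x \<in> T" by induction (use assms in auto)
qed

lemma sgen_subset: "A \<subseteq> sgen f B \<Longrightarrow> sgen f A \<subseteq> sgen f B"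
  by (rule sgen_least) (auto intro: sgen.mult)

lemma sgen_mono: "A \<subseteq> B \<Longrightarrow> sgen f A \<subseteq> sgen f B"
  by (rule sgen_subset) (auto intro: sgen.base)

text \<open>A finite generating set contained in every other one attains the minimum. Since
  \<open>G\<close> consists of idempotents, it competes in both infima and settles both ranks at
  once.\<close>

lemma rank_eq_card:
  assumes "G \<subseteq> idempotents f S" "finite G" "sgen f G = S"
    and least: "\<And>A. A \<subseteq> S \<Longrightarrow> sgen f A = S \<Longrightarrow> G \<subseteq> A"
  shows "srank f S = enat (card G)" "idrank f S = enat (card G)"
proof -
  have sub: "idempotents f S \<subseteq> S" by (auto simp: idempotents_def)
  have le: "enat (card G) \<le> enat (card A)" if "A \<subseteq> S" "finite A" "sgen f A = S" for A
    using least[OF that(1,3)] that(2) by (simp add: card_mono)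
  have GS: "G \<subseteq> S" using assms(1) sub by simp
  show "srank f S = enat (card G)"
    unfolding srank_def
  proof (rule antisym)
    show "(INF A\<in>{A. A \<subseteq> S \<and> finite A \<and> sgen f A = S}. enat (card A)) \<le> enat (card G)"
      by (rule INF_lower) (simp add: GS assms(2,3))
  qed (rule INF_greatest, use le in blast)
  show "idrank f S = enat (card G)"
    unfolding idrank_def
  proof (rule antisym)
    show "(INF A\<in>{A. A \<subseteq> idempotents f S \<and> finite A \<and> sgen f A = S}. enat (card A)) \<le> enat (card G)"
      by (rule INF_lower) (simp add: assms(1-3))
  qed (rule INF_greatest, use sub le in blast)
qed

section \<open>Composition of partial maps and the semigroup \<open>LS n\<close>\<close>

lemma pcomp_Some: "pcomp a b x = Some z \<longleftrightarrow> (\<exists>y. a x = Some y \<and> b y = Some z)"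
  by (auto simp: pcomp_def map_comp_def split: option.splits)

lemma pcomp_assoc: "pcomp (pcomp a b) c = pcomp a (pcomp b c)"
  by (auto simp: pcomp_def map_comp_def split: option.splits)

lemma map_eqI: "(\<And>x y. a x = Some y \<longleftrightarrow> b x = Some y) \<Longrightarrow> a = b"
  by (rule ext, metis option.exhaust)

lemma ran_pcomp: "ran (pcomp a b) \<subseteq> ran b"
  by (auto simp: ran_def pcomp_Some)

text \<open>Pointwise form for checking membership of maps given by explicit graphs. The chain
  \<open>1 \<le> y \<le> x \<le> n\<close> carries both range conditions as well as
  order-decrease.\<close>

lemma LS_iff:
  "a \<in> LS n \<longleftrightarrow> (\<forall>x y. a x = Some y \<longrightarrow> 1 \<le> y \<and> y \<le> x \<and> x \<le> n) \<and>
    (\<forall>x x' y y'. a x = Some y \<longrightarrow> a x' = Some y' \<longrightarrow> x \<le> x' \<longrightarrow> y \<le> y')"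
  (is "_ \<longleftrightarrow> ?R")
proof
  assume "a \<in> LS n"
  then have a: "dom a \<subseteq> {1..n}" "ran a \<subseteq> {1..n}" "isotone a" "order_decreasing a"
    by (auto simp: LS_def)
  have "1 \<le> y \<and> y \<le> x \<and> x \<le> n" if "a x = Some y" for x y
  proof -
    have "x \<in> {1..n}" "y \<in> {1..n}" using that a(1,2) by (blast intro: ranI)+
    moreover have "y \<le> x" using that a(4) by (metis domI option.sel order_decreasing_def)
    ultimately show ?thesis by simp
  qed
  moreover have "y \<le> y'" if "a x = Some y" "a x' = Some y'" "x \<le> x'" for x x' y y'
    using that a(3) by (metis domI isotone_def option.sel)
  ultimately show ?R by blast
next
  assume R: ?R
  have "x \<in> {1..n} \<and> y \<in> {1..n}" if "a x = Some y" for x y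
    using R that by (meson atLeastAtMost_iff order_trans)
  then have "dom a \<subseteq> {1..n}" "ran a \<subseteq> {1..n}" by (auto simp: ran_def)
  moreover have "isotone a" using R by (auto simp: isotone_def)
  moreover have "order_decreasing a" using R by (auto simp: order_decreasing_def)
  ultimately show "a \<in> LS n" by (simp add: LS_def)
qed

lemma LS_le: "a \<in> LS n \<Longrightarrow> a x = Some y \<Longrightarrow> 1 \<le> y \<and> y \<le> x \<and> x \<le> n"
  and LS_mono: "a \<in> LS n \<Longrightarrow> a x = Some y \<Longrightarrow> a x' = Some y' \<Longrightarrow> x \<le> x' \<Longrightarrow> y \<le> y'"
  by (auto simp: LS_iff)

lemma finite_ran_LS: "a \<in> LS n \<Longrightarrow> finite (ran a)"
  by (rule finite_subset[of _ "{1..n}"]) (auto simp: LS_def)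

lemma card_ran_LS: "a \<in> LS n \<Longrightarrow> card (ran a) \<le> n"
  using card_mono[of "{1..n}" "ran a"] by (auto simp: LS_def)

lemma finite_LS: "finite (LS n)"
proof (rule finite_subset)
  show "LS n \<subseteq> (\<Union>D\<in>Pow {1..n}. {m. dom m = D \<and> ran m \<subseteq> {1..n}})"
    by (auto simp: LS_def)
  show "finite (\<Union>D\<in>Pow {1..n}. {m::nat \<rightharpoonup> nat. dom m = D \<and> ran m \<subseteq> {1..n}})"
    by (rule finite_UN_I) (auto intro!: finite_set_of_finite_maps intro: finite_subset)
qed

lemma pcomp_LS: "a \<in> LS n \<Longrightarrow> b \<in> LS n \<Longrightarrow> pcomp a b \<in> LS n"
  unfolding LS_iff pcomp_Some by (meson order_trans)

lemma pcomp_K: "a \<in> K n p \<Longrightarrow> b \<in> K n p \<Longrightarrow> pcomp a b \<in> K n p"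
  using card_mono[OF finite_ran_LS ran_pcomp, of b n a]
  by (auto simp: K_def pcomp_LS)

section \<open>Idempotents of given rank and their forced presence in generating sets\<close>

lemma idem_Jstar_iff:
  "e \<in> idempotents pcomp (Jstar n p) \<longleftrightarrow>
    e \<in> LS n \<and> card (ran e) = p \<and> (\<forall>x y. e x = Some y \<longrightarrow> e y = Some y)"
proof -
  have "pcomp e e = e \<longleftrightarrow> (\<forall>x y. e x = Some y \<longrightarrow> e y = Some y)"
  proof
    assume "pcomp e e = e"
    then show "\<forall>x y. e x = Some y \<longrightarrow> e y = Some y"
      by (metis option.inject pcomp_Some)
  next
    assume *: "\<forall>x y. e x = Some y \<longrightarrow> e y = Some y"
    show "pcomp e e = e"
      using * by (intro map_eqI) (auto simp: pcomp_Some)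
  qed
  then show ?thesis by (auto simp: idempotents_def Jstar_def)
qed

lemma idem_left_factor_eq:
  assumes e: "e \<in> idempotents pcomp (Jstar n q)" and "x \<in> LS n" "s \<in> LS n"
    and xs: "pcomp x s = e" and card: "card (ran x) \<le> q"
  shows "x = e"
proof -
  have fixed: "x t = Some t \<and> s t = Some t" if "t \<in> ran e" for t
  proof -
    have "e t = Some t" using e that by (auto simp: idem_Jstar_iff ran_def)
    then obtain v where v: "x t = Some v" "s v = Some t"
      using xs by (metis pcomp_Some)
    \<comment> \<open>Neither factor moves a point up: \<open>v \<le> t\<close> from
      \<open>x\<close>, and \<open>t \<le> v\<close> from \<open>s\<close>.\<close>
    then have "v = t" using LS_le[OF assms(2) v(1)] LS_le[OF assms(3) v(2)] by simp
    then show ?thesis using v by simp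
  qed
  \<comment> \<open>The image of \<open>e\<close> lies in that of \<open>x\<close>, and the rank
    bound makes them equal. Hence \<open>s\<close> fixes all of \<open>ran x\<close>, and
    multiplying by it changes nothing.\<close>
  have "ran e = ran x"
    using fixed card e finite_ran_LS[OF assms(2)]
    by (intro card_seteq) (auto simp: idem_Jstar_iff intro: ranI)
  then have "s v = Some v" if "x u = Some v" for u v
    using that fixed ranI by metis
  then show ?thesis
    unfolding xs[symmetric] by (intro map_eqI) (metis option.inject pcomp_Some)
qed

definition pid :: "nat set \<Rightarrow> (nat \<rightharpoonup> nat)" where
  "pid D = (\<lambda>x. if x \<in> D then Some x else None)"

lemma pid_Some [simp]: "pid D x = Some y \<longleftrightarrow> x \<in> D \<and> y = x"
  by (auto simp: pid_def)

lemma ran_pid [simp]: "ran (pid D) = D"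
  by (auto simp: ran_def)

lemma pid_idem: "D \<subseteq> {1..n} \<Longrightarrow> pid D \<in> idempotents pcomp (Jstar n (card D))"
  by (auto simp: idem_Jstar_iff LS_iff)

lemma pid_left: "a \<in> LS n \<Longrightarrow> pcomp (pid {1..n}) a = a"
  by (rule map_eqI) (auto simp: pcomp_Some dest: LS_le)

lemma idempotents_top: "idempotents pcomp (Jstar n n) = {pid {1..n}}"
  by (simp add: idempotents_Jstar_top pid_def)

text \<open>The second alternative only matters for \<open>K n n\<close>, where the identity can be
  prepended to any factorisation.\<close>

lemma idem_in_generators:
  assumes e: "e \<in> idempotents pcomp (Jstar n q)" and A: "A \<subseteq> LS n"
    and small: "\<And>x. x \<in> A \<Longrightarrow> card (ran x) \<le> q \<or> (x = pid {1..n} \<and> q < n)"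
    and "e \<in> sgen pcomp A"
  shows "e \<in> A"
proof -
  have sub: "sgen pcomp A \<subseteq> LS n"
    using A by (rule sgen_least) (rule pcomp_LS)
  \<comment> \<open>The cofactor \<open>s\<close> is arbitrary so that associativity can move
    \<open>y\<close> into it. If the left part \<open>x\<close> is the identity, it cancels and the
    claim for \<open>y\<close> takes over.\<close>
  have key: "e \<in> A \<or> (x = pid {1..n} \<and> q < n)"
    if "x \<in> sgen pcomp A" "s \<in> LS n" "pcomp x s = e" for x s
    using that
  proof (induction arbitrary: s)
    case (base x)
    then show ?case
      using small[of x] idem_left_factor_eq[OF e, of x s] A by auto
  next
    case (mult x y)
    have "y \<in> LS n" using mult.hyps sub by blast
    then have ys: "pcomp y s \<in> LS n" using mult.prems by (simp add: pcomp_LS)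
    have "pcomp x (pcomp y s) = e" using mult.prems by (simp add: pcomp_assoc)
    from mult.IH(1)[OF ys this] show ?case
      using mult.IH(2)[of s] mult.prems ys pid_left \<open>y \<in> LS n\<close> by metis
  qed
  have "e \<in> LS n" "pcomp e e = e" "card (ran e) = q"
    using e by (auto simp: idempotents_def Jstar_def)
  \<comment> \<open>With \<open>x = s = e\<close>, the alternative that \<open>e\<close> is the
    identity would give it rank \<open>n\<close> instead of \<open>q < n\<close>.\<close>
  then show ?thesis using key[of e e] assms(4) by auto
qed

section \<open>Maps of rank \<open>p\<close> as products of idempotents of rank
  \<open>p\<close>\<close>

lemma card_ran_inj:
  assumes "inj_on a (dom a)"
  shows "card (ran a) = card (dom a)"
proof -
  have "bij_betw (\<lambda>x. the (a x)) (dom a) (ran a)"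
    using assms by (auto simp: bij_betw_def inj_on_def ran_def dom_def image_def)
  then show ?thesis by (simp add: bij_betw_same_card)
qed

text \<open>The least moved point \<open>a\<close> can be sent to its image \<open>b\<close> first: no point of the domain lies in
  \<open>[b, a)\<close>, so sending \<open>a\<close> to \<open>b\<close> and fixing everything else is an idempotent of the same rank.\<close>

lemma inj_in_sgen_idem:
  assumes "\<beta> \<in> LS n" "inj_on \<beta> (dom \<beta>)"
  shows "\<beta> \<in> sgen pcomp (idempotents pcomp (Jstar n (card (ran \<beta>))))"
  using assms
proof (induction "card {x \<in> dom \<beta>. \<beta> x \<noteq> Some x}" arbitrary: \<beta> rule: less_induct)
  case less
  let ?M = "{x \<in> dom \<beta>. \<beta> x \<noteq> Some x}"
  let ?E = "idempotents pcomp (Jstar n (card (ran \<beta>)))"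
  have dom: "dom \<beta> \<subseteq> {1..n}" using less.prems(1) by (simp add: LS_def)
  then have fin: "finite (dom \<beta>)" by (rule finite_subset) simp
  have inj: "x = x'" if "\<beta> x = Some y" "\<beta> x' = Some y" for x x' y
    using less.prems(2) that by (auto simp: inj_on_def dom_def)
  note L = LS_le[OF less.prems(1)] and M = LS_mono[OF less.prems(1)]
  have e: "pid (dom \<beta>) \<in> ?E"
    using pid_idem[OF dom] card_ran_inj[OF less.prems(2)] by simp
  show ?case
  proof (cases "?M = {}")
    case True
    then have "\<beta> = pid (dom \<beta>)"
      by (intro map_eqI) (auto simp: dom_def, (metis option.distinct(1) option.inject)+)
    then show ?thesis using e by (metis sgen.base)
  next
    case False
    define a where "a = Min ?M"
    have "finite ?M" using fin by simp
    then have aM: "a \<in> ?M" and least: "\<And>x. x \<in> ?M \<Longrightarrow> a \<le> x"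
      using Min_in[OF _ False] Min_le[of ?M] unfolding a_def by blast+
    then obtain b where b: "\<beta> a = Some b" "b \<noteq> a" by auto
    have ba: "b < a" "1 \<le> b" "a \<le> n" using L[OF b(1)] b(2) by auto
    \<comment> \<open>Points of the domain below \<open>a\<close> are fixed by minimality of
      \<open>a\<close>; isotonicity and injectivity then put them strictly below
      \<open>b\<close>.\<close>
    have below: "y = x \<and> x < b" if "\<beta> x = Some y" "x < a" for x y
    proof -
      have "y = x" using least[of x] that by force
      moreover have "y \<le> b" using M[OF that(1) b(1)] that(2) by simp
      moreover have "y \<noteq> b" using inj[OF that(1), of a] b(1) that(2) by auto
      ultimately show ?thesis by simp
    qed
    have b_none: "\<beta> b = None" using below[of b] ba by (cases "\<beta> b") auto
    \<comment> \<open>\<open>f\<close> performs the single move from \<open>a\<close> to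
      \<open>b\<close>, and is made to fix \<open>b\<close> so as to be idempotent. The remaining
      map \<open>\<beta>'\<close> starts from \<open>b\<close> in place of \<open>a\<close>.\<close>
    define f where "f = (pid (dom \<beta> \<union> {b}))(a := Some b)"
    define \<beta>' where "\<beta>' = \<beta>(a := None, b := Some b)"
    have f_Some: "f x = Some y \<longleftrightarrow> (x = a \<and> y = b) \<or> (x = b \<and> y = b) \<or> (x \<noteq> a \<and> x \<in> dom \<beta> \<and> y = x)"
      for x y using ba by (auto simp: f_def)
    have b'_Some: "\<beta>' x = Some y \<longleftrightarrow> (x = b \<and> y = b) \<or> (x \<noteq> a \<and> \<beta> x = Some y)" for x y
      using ba b_none by (auto simp: \<beta>'_def)
    have between: "x < b \<or> a < x" if "x \<in> dom \<beta>" "x \<noteq> a" for x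
      using that below by (meson domD linorder_neqE_nat)
    have fLS: "f \<in> LS n"
      unfolding LS_iff f_Some using ba between dom by (auto, (force dest: between)+)
    have ranf: "ran f = insert b (dom \<beta> - {a})"
      by (auto simp: ran_def f_Some)
    have "card (ran f) = card (dom \<beta>)"
      unfolding ranf using fin aM b_none card_Suc_Diff1[of "dom \<beta>" a]
      by (subst card_insert_disjoint) auto
    then have fE: "f \<in> ?E"
      using fLS card_ran_inj[OF less.prems(2)] by (auto simp: idem_Jstar_iff f_Some)
    have b'LS: "\<beta>' \<in> LS n"
      unfolding LS_iff
    proof (intro conjI allI impI)
      fix x y assume "\<beta>' x = Some y"
      then show "1 \<le> y" "y \<le> x" "x \<le> n" using L[of x y] ba by (auto simp: b'_Some)
    next
      fix x x' y y'
      assume h: "\<beta>' x = Some y" "\<beta>' x' = Some y'" "x \<le> x'"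
      show "y \<le> y'"
      proof (cases "x = b")
        case True
        then have "y = b" using h(1) b_none by (auto simp: b'_Some)
        show ?thesis
        proof (cases "x' = b")
          case True
          then show ?thesis using h(2) \<open>y = b\<close> b_none by (auto simp: b'_Some)
        next
          case False
          then have x': "\<beta> x' = Some y'" "x' \<noteq> a" using h(2) by (auto simp: b'_Some)
          then have "a < x'" using between[of x'] h(3) \<open>x = b\<close> by auto
          then show ?thesis using M[OF b(1) x'(1)] \<open>y = b\<close> by simp
        qed
      next
        case False
        then have x: "\<beta> x = Some y" "x \<noteq> a" using h(1) by (auto simp: b'_Some)
        show ?thesis
        proof (cases "x' = b")
          case True
          then have "y' = b" using h(2) b_none by (auto simp: b'_Some)
          then show ?thesis using L[OF x(1)] h(3) True by simp
        next
          case False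
          then show ?thesis using h x M by (auto simp: b'_Some)
        qed
      qed
    qed
    have ranb': "ran \<beta>' = ran \<beta>"
    proof (intro set_eqI iffI)
      fix y assume "y \<in> ran \<beta>'"
      then show "y \<in> ran \<beta>" using b(1) by (auto simp: ran_def b'_Some)
    next
      fix y assume "y \<in> ran \<beta>"
      then obtain x where "\<beta> x = Some y" by (auto simp: ran_def)
      then have "\<beta>' (if x = a then b else x) = Some y"
        using b(1) by (auto simp: b'_Some)
      then show "y \<in> ran \<beta>'" by (rule ranI)
    qed
    have b'inj: "inj_on \<beta>' (dom \<beta>')"
    proof (rule inj_onI)
      fix x x' assume h: "x \<in> dom \<beta>'" "x' \<in> dom \<beta>'" "\<beta>' x = \<beta>' x'"
      then obtain y where "\<beta>' x = Some y" "\<beta>' x' = Some y" by auto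
      then show "x = x'" unfolding b'_Some using inj b(1) by blast
    qed
    \<comment> \<open>\<open>\<beta>'\<close> drops \<open>a\<close> and fixes \<open>b\<close>, so
      it moves fewer points; its image is unchanged, so the induction stays with the same
      idempotents.\<close>
    have "{x \<in> dom \<beta>'. \<beta>' x \<noteq> Some x} \<subseteq> ?M - {a}"
      by (auto simp: b'_Some)
    then have "card {x \<in> dom \<beta>'. \<beta>' x \<noteq> Some x} < card ?M"
      using \<open>finite ?M\<close> aM by (meson card_Diff1_less card_mono finite_Diff le_less_trans)
    from less.hyps[OF this b'LS b'inj]
    have "\<beta>' \<in> sgen pcomp ?E" by (simp add: ranb')
    \<comment> \<open>The leading partial identity deletes \<open>b\<close>, where \<open>f\<close>
      is defined but \<open>\<beta>\<close> is not.\<close>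
    moreover have "\<beta> = pcomp (pid (dom \<beta>)) (pcomp f \<beta>')"
    proof (rule map_eqI)
      fix x y
      have "pcomp (pid (dom \<beta>)) (pcomp f \<beta>') x = Some y \<longleftrightarrow>
          x \<in> dom \<beta> \<and> (\<exists>z. f x = Some z \<and> \<beta>' z = Some y)"
        by (simp add: pcomp_Some)
      also have "\<dots> \<longleftrightarrow> \<beta> x = Some y"
      proof (cases "x = a")
        case True
        then have "f x = Some z \<longleftrightarrow> z = b" for z using ba by (simp add: f_Some)
        then show ?thesis using True b b_none by (auto simp: b'_Some)
      next
        case False
        then have "f x = Some z \<longleftrightarrow> z = x" if "x \<in> dom \<beta>" for z
          using that by (auto simp: f_Some)
        moreover have "\<beta>' x = \<beta> x" if "x \<in> dom \<beta>"
          using that False b_none by (auto simp: \<beta>'_def)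
        ultimately show ?thesis by (metis domI)
      qed
      finally show "\<beta> x = Some y \<longleftrightarrow> pcomp (pid (dom \<beta>)) (pcomp f \<beta>') x = Some y" by simp
    qed
    ultimately show ?thesis
      using e fE by (metis sgen.base sgen.mult)
  qed
qed

text \<open>Factor \<open>\<alpha>\<close> as \<open>e\<close> followed by \<open>\<beta>\<close>:
  the idempotent \<open>e\<close> has the blocks of \<open>\<alpha>\<close>, and
  \<open>\<beta>\<close> is injective because it keeps one representative of each block.\<close>

lemma Jstar_subset_sgen: "Jstar n p \<subseteq> sgen pcomp (idempotents pcomp (Jstar n p))"
proof
  fix \<alpha> assume "\<alpha> \<in> Jstar n p"
  then have \<alpha>: "\<alpha> \<in> LS n" and card: "card (ran \<alpha>) = p" by (auto simp: Jstar_def)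
  note L = LS_le[OF \<alpha>] and M = LS_mono[OF \<alpha>]
  \<comment> \<open>The representative must be the least point of its block: any other would make
    \<open>e\<close> send that least point upwards.\<close>
  define m where "m y = (LEAST z. \<alpha> z = Some y)" for y
  have m: "\<alpha> (m y) = Some y" "m y \<le> x" if "\<alpha> x = Some y" for x y
    using LeastI[of "\<lambda>z. \<alpha> z = Some y", OF that] Least_le[of "\<lambda>z. \<alpha> z = Some y", OF that]
    by (auto simp: m_def)
  define e where "e = (\<lambda>x. map_option m (\<alpha> x))"
  define \<beta> where "\<beta> = \<alpha> |` ran e"
  have e_Some: "e x = Some z \<longleftrightarrow> (\<exists>y. \<alpha> x = Some y \<and> z = m y)" for x z
    by (auto simp: e_def)
  have b_Some: "\<beta> x = Some y \<longleftrightarrow> \<alpha> x = Some y \<and> x = m y" for x y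
    by (auto simp: \<beta>_def restrict_map_def ran_def e_Some m)
  have ranb: "ran \<beta> = ran \<alpha>"
    by (auto simp: ran_def b_Some dest: m)
  have domb: "dom \<beta> = ran e"
    using m by (fastforce simp: ran_def b_Some e_Some)
  have inj: "inj_on \<beta> (dom \<beta>)"
    by (rule inj_onI) (auto simp: b_Some)
  have "\<beta> \<in> LS n" using \<alpha> by (auto simp: LS_iff b_Some)
  from inj_in_sgen_idem[OF this inj]
  have bE: "\<beta> \<in> sgen pcomp (idempotents pcomp (Jstar n p))"
    by (simp add: ranb card)
  \<comment> \<open>If the minima were in reverse order, isotonicity at the minima and at
    \<open>x\<close>, \<open>x'\<close> would give both \<open>y' \<le> y\<close> and
    \<open>y \<le> y'\<close>, so the blocks would coincide.\<close>
  have "m y \<le> m y'" if "\<alpha> x = Some y" "\<alpha> x' = Some y'" "x \<le> x'" for x x' y y'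
  proof (rule ccontr)
    assume "\<not> m y \<le> m y'"
    then have "y' \<le> y" using M[OF m(1)[OF that(2)] m(1)[OF that(1)]] by simp
    then have "y = y'" using M[OF that] by simp
    then show False using \<open>\<not> m y \<le> m y'\<close> by simp
  qed
  moreover have "1 \<le> m y \<and> m y \<le> x \<and> x \<le> n" if "\<alpha> x = Some y" for x y
    using m[OF that] L[OF that] L[OF m(1)[OF that]] by simp
  ultimately have "e \<in> LS n"
    by (auto simp: LS_iff e_Some)
  then have "e \<in> idempotents pcomp (Jstar n p)"
    using card_ran_inj[OF inj] card by (auto simp: idem_Jstar_iff e_Some ranb domb dest: m)
  moreover have "\<alpha> = pcomp e \<beta>"
    by (rule map_eqI) (auto simp: pcomp_Some e_Some b_Some m dest: m)
  ultimately show "\<alpha> \<in> sgen pcomp (idempotents pcomp (Jstar n p))"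
    using bE by (metis sgen.base sgen.mult)
qed

section \<open>Descending to lower ranks\<close>

text \<open>Two extra points outside the image make room: if no point is moved, the factors are the partial
  identities that add one of them each. Otherwise the top point \<open>c\<close> of a nontrivial block over \<open>a\<close> is
  sent to \<open>a\<close> through a detour \<open>u\<close>, while the second factor keeps its rank by fixing \<open>v\<close>; the choice of
  \<open>u\<close> and \<open>v\<close> keeps \<open>v\<close> out of \<open>[a, u]\<close>, as isotonicity demands.\<close>

lemma idem_in_next_products:
  assumes e: "e \<in> idempotents pcomp (Jstar n r)" and r: "r + 2 \<le> n"
  shows "e \<in> sgen pcomp (Jstar n (Suc r))"
proof -
  have eLS: "e \<in> LS n" and card: "card (ran e) = r"
    and idem: "\<And>x y. e x = Some y \<Longrightarrow> e y = Some y"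
    using e by (auto simp: idem_Jstar_iff)
  note L = LS_le[OF eLS] and M = LS_mono[OF eLS]
  let ?F = "ran e"
  have F: "?F \<subseteq> {1..n}" "finite ?F" using eLS finite_ran_LS by (auto simp: LS_def)
  have eF: "e x = Some x" if "x \<in> ?F" for x
    using that idem by (auto simp: ran_def)
  have another: "\<exists>d. d \<in> {1..n} \<and> d \<notin> ?F \<and> d \<noteq> c" for c
  proof (rule ccontr)
    assume "\<not> ?thesis"
    then have "{1..n} \<subseteq> insert c ?F" by auto
    then have "n \<le> card (insert c ?F)" using F(2) card_mono[of "insert c ?F" "{1..n}"] by simp
    then show False using r card F(2) by (simp add: card_insert_if split: if_splits)
  qed
  have prod: "e \<in> sgen pcomp (Jstar n (Suc r))"
    if "g \<in> Jstar n (Suc r)" "h \<in> Jstar n (Suc r)" "e = pcomp g h" for g h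
    using that by (auto intro: sgen.intros)
  show ?thesis
  proof (cases "\<forall>x y. e x = Some y \<longrightarrow> x = y")
    case True
    obtain d where d: "d \<in> {1..n}" "d \<notin> ?F" using another by blast
    obtain c where c: "c \<in> {1..n}" "c \<notin> ?F" "c \<noteq> d" using another by blast
    have J: "pid (insert z ?F) \<in> Jstar n (Suc r)" if "z \<in> {1..n}" "z \<notin> ?F" for z
      using pid_idem[of "insert z ?F" n] that F card by (auto simp: idempotents_def)
    have "e = pcomp (pid (insert c ?F)) (pid (insert d ?F))"
      using True c d eF by (intro map_eqI) (auto simp: pcomp_Some intro: ranI)
    then show ?thesis using prod J c d by blast
  next
    case False
    then obtain x0 a where x0: "e x0 = Some a" "x0 \<noteq> a" by blast
    \<comment> \<open>The top of the block is taken so that larger points have images beyond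
      \<open>c\<close>; redirecting \<open>c\<close> to some \<open>u \<le> c\<close> then keeps
      isotonicity.\<close>
    define c where "c = Max {x. e x = Some a}"
    have "finite {x. e x = Some a}"
      by (rule finite_subset[of _ "{..n}"]) (auto dest: L)
    then have "c \<in> {x. e x = Some a}" and cmax: "\<And>x. e x = Some a \<Longrightarrow> x \<le> c"
      using Max_in[of "{x. e x = Some a}"] x0 by (auto simp: c_def)
    then have c: "e c = Some a" by simp
    have a: "e a = Some a" "a \<in> ?F" using idem[OF x0(1)] by (auto intro: ranI)
    have ac: "a < c" using cmax[OF x0(1)] L[OF x0(1)] x0(2) by simp
    have "c \<in> {1..n}" using L[OF c] by simp
    have block: "y = a" if "e x = Some y" "a \<le> x" "x \<le> c" for x y
      using M[OF a(1) that(1,2)] M[OF that(1) c that(3)] by simp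
    \<comment> \<open>Image points are fixed, whereas every domain point in \<open>[a, c]\<close> is
      sent to \<open>a\<close>; so the image avoids \<open>(a, c]\<close>.\<close>
    have gap: "z \<le> a \<or> c < z" if "z \<in> ?F" for z
      using block[OF eF[OF that]] by force
    have above: "c < y" if "e x = Some y" "c < x" for x y
    proof -
      have "a \<le> y" using M[OF c that(1)] that(2) by simp
      moreover have "y \<noteq> a" using cmax[of x] that by auto
      ultimately show ?thesis using gap[of y] that(1) by (force intro: ranI)
    qed
    have "c \<notin> ?F" using eF[of c] c ac by auto
    obtain d where d: "d \<in> {1..n}" "d \<notin> ?F" "d \<noteq> c" using another by blast
    \<comment> \<open>If \<open>d\<close> lies in \<open>(a, c)\<close>, it is the detour and
      \<open>c\<close> is kept. Otherwise \<open>c\<close> is its own detour, so that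
      \<open>g\<close> fixes it, and \<open>d\<close> is kept, lying outside
      \<open>[a, c]\<close>.\<close>
    obtain u v where uv: "u \<in> {1..n}" "v \<in> {1..n}" "u \<notin> ?F" "v \<notin> ?F"
      "a < u" "u \<le> c" "v < a \<or> u < v"
    proof (cases "a < d \<and> d < c")
      case True
      then show ?thesis using that[of d c] d \<open>c \<in> {1..n}\<close> \<open>c \<notin> ?F\<close> by simp
    next
      case False
      have "d \<noteq> a" using d a by auto
      then have "d < a \<or> c < d" using False d by linarith
      then show ?thesis using that[of c d] d \<open>c \<in> {1..n}\<close> \<open>c \<notin> ?F\<close> ac by simp
    qed
    define g where "g = e(c := Some u)"
    define h where "h = (pid (insert v ?F))(u := Some a)"
    have g_Some: "g x = Some y \<longleftrightarrow> (x = c \<and> y = u) \<or> (x \<noteq> c \<and> e x = Some y)" for x y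
      by (auto simp: g_def)
    have h_Some: "h x = Some y \<longleftrightarrow> (x = u \<and> y = a) \<or> (x = v \<and> y = v) \<or> (x \<in> ?F \<and> y = x)" for x y
      using uv by (auto simp: h_def)
    have "1 \<le> a" using L[OF c] by simp
    have gLS: "g \<in> LS n"
      unfolding LS_iff
    proof (intro conjI allI impI)
      fix x y assume "g x = Some y"
      then show "1 \<le> y" "y \<le> x" "x \<le> n"
        using L[of x y] uv \<open>c \<in> {1..n}\<close> by (auto simp: g_Some)
    next
      fix x x' y y'
      assume h: "g x = Some y" "g x' = Some y'" "x \<le> x'"
      consider "x = c" "x' = c" | "x = c" "c < x'" | "x' = c" "x < c" | "x \<noteq> c" "x' \<noteq> c"
        using h(3) by fastforce
      then show "y \<le> y'"
      proof cases
        case 2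
        then show ?thesis using h above[of x' y'] uv by (auto simp: g_Some)
      next
        case 3
        then show ?thesis using h M[of x y c a] c uv by (auto simp: g_Some)
      qed (use h M in \<open>auto simp: g_Some\<close>)
    qed
    have "ran g = insert u ?F"
    proof (intro set_eqI iffI)
      fix y assume "y \<in> insert u ?F"
      then have "g (if y = u then c else y) = Some y"
        using eF[of y] \<open>c \<notin> ?F\<close> uv by (auto simp: g_Some)
      then show "y \<in> ran g" by (rule ranI)
    qed (auto simp: ran_def g_Some)
    then have gJ: "g \<in> Jstar n (Suc r)"
      using gLS uv F card by (simp add: Jstar_def)
    have gap': "z \<le> a \<or> u < z" if "z \<in> ?F" for z
      using gap[OF that] uv by auto
    have hLS: "h \<in> LS n"
      unfolding LS_iff
    proof (intro conjI allI impI)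
      fix x y assume "h x = Some y"
      then show "1 \<le> y" "y \<le> x" "x \<le> n"
        using uv F(1) \<open>1 \<le> a\<close> by (auto simp: h_Some)
    next
      fix x x' y y'
      assume h: "h x = Some y" "h x' = Some y'" "x \<le> x'"
      then show "y \<le> y'"
        using uv gap'[of x] gap'[of x'] by (auto simp: h_Some)
    qed
    have "ran h = insert v ?F"
      using a(2) by (auto simp: ran_def[of h] h_Some)
    then have hJ: "h \<in> Jstar n (Suc r)"
      using hLS uv F card by (simp add: Jstar_def)
    \<comment> \<open>On the image of \<open>g\<close>, which is \<open>u\<close> together with
      \<open>ran e\<close>, the map \<open>h\<close> sends \<open>u\<close> to \<open>a\<close> and
      fixes the rest; \<open>v\<close> lies outside that image.\<close>
    have "e = pcomp g h"
    proof (rule map_eqI)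
      fix x y
      show "e x = Some y \<longleftrightarrow> pcomp g h x = Some y"
      proof (cases "x = c")
        case True
        then show ?thesis using c uv by (auto simp: pcomp_Some g_Some h_Some)
      next
        case False
        then show ?thesis using uv by (auto simp: pcomp_Some g_Some h_Some intro: ranI)
      qed
    qed
    then show ?thesis using prod gJ hJ by blast
  qed
qed

text \<open>Downward induction from \<open>p\<close>: \<open>r < p < n\<close> leaves the two spare
  points needed to write rank \<open>r\<close> idempotents as products of rank \<open>r + 1\<close>,
  and those idempotents yield all maps of rank \<open>r\<close>.\<close>

lemma Jstar_subset_sgen_higher:
  assumes "r \<le> p" "p < n"
  shows "Jstar n r \<subseteq> sgen pcomp (idempotents pcomp (Jstar n p))"
  using assms
proof (induction rule: inc_induct)
  case base
  show ?case by (rule Jstar_subset_sgen)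
next
  case (step r)
  have "idempotents pcomp (Jstar n r) \<subseteq> sgen pcomp (Jstar n (Suc r))"
    using idem_in_next_products step by auto
  also have "\<dots> \<subseteq> sgen pcomp (idempotents pcomp (Jstar n p))"
    using step by (intro sgen_subset) simp
  finally show ?case
    using sgen_subset Jstar_subset_sgen by blast
qed

section \<open>Rank and idempotent rank of \<open>K n p\<close>\<close>

lemma idem_Jstar_subset: "p \<le> q \<Longrightarrow> idempotents pcomp (Jstar n p) \<subseteq> idempotents pcomp (K n q)"
  by (auto simp: idempotents_def Jstar_def K_def)

lemma sgen_subset_K: "A \<subseteq> K n p \<Longrightarrow> sgen pcomp A \<subseteq> K n p"
  by (erule sgen_least) (rule pcomp_K)

lemma finite_idem: "finite (idempotents pcomp (Jstar n p))"
  by (rule finite_subset[OF _ finite_LS[of n]]) (auto simp: idem_Jstar_iff)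

lemma idempotents_K_subset: "idempotents pcomp (K n p) \<subseteq> K n p"
  by (auto simp: idempotents_def)

lemma K_subset_sgen:
  assumes "p < n"
  shows "K n p \<subseteq> sgen pcomp (idempotents pcomp (Jstar n p))"
  using Jstar_subset_sgen_higher[OF _ assms] by (auto simp: K_def Jstar_def)

lemma rank_K_less:
  assumes "p < n"
  shows "srank pcomp (K n p) = enat (card (idempotents pcomp (Jstar n p)))"
    and "idrank pcomp (K n p) = enat (card (idempotents pcomp (Jstar n p)))"
proof -
  let ?G = "idempotents pcomp (Jstar n p)"
  have G: "?G \<subseteq> idempotents pcomp (K n p)" by (rule idem_Jstar_subset) simp
  have gen: "sgen pcomp ?G = K n p"
    using sgen_subset_K[OF order_trans[OF G idempotents_K_subset]] K_subset_sgen[OF assms] by blast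
  have least: "?G \<subseteq> A" if "A \<subseteq> K n p" "sgen pcomp A = K n p" for A
    using that G by (auto intro!: idem_in_generators[of _ n p A] simp: K_def idempotents_def)
  note rank_eq_card[OF G finite_idem gen least]
  then show "srank pcomp (K n p) = enat (card ?G)" "idrank pcomp (K n p) = enat (card ?G)"
    by blast+
qed

text \<open>Maps of rank \<open>n\<close> are products of idempotents of rank \<open>n\<close>, of
  which the identity is the only one.\<close>

lemma Jstar_top: "Jstar n n \<subseteq> {pid {1..n}}"
proof -
  have "pid {1..n} \<in> LS n" by (auto simp: LS_iff)
  then have "sgen pcomp {pid {1..n}} \<subseteq> {pid {1..n}}"
    by (intro sgen_least) (auto dest: pid_left)
  then show ?thesis using Jstar_subset_sgen[of n n] by (auto simp: idempotents_top)
qed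

text \<open>Apart from the identity, every map has rank at most \<open>n - 1\<close> and is thus
  generated by the idempotents of rank \<open>n - 1\<close>. For \<open>n = 1\<close> these reduce
  to the empty map.\<close>

lemma srank_eq_idrank_top:
  assumes "1 \<le> n"
  shows "srank pcomp (K n n) = idrank pcomp (K n n)"
proof -
  let ?E = "\<lambda>q. idempotents pcomp (Jstar n q)"
  let ?G = "?E (n - 1) \<union> ?E n"
  have G: "?G \<subseteq> idempotents pcomp (K n n)"
    using idem_Jstar_subset by (meson Un_least diff_le_self order_refl)
  have KE: "K n n \<subseteq> K n (n - 1) \<union> Jstar n n"
    by (auto simp: K_def Jstar_def)
  also have "\<dots> \<subseteq> sgen pcomp (?E (n - 1)) \<union> sgen pcomp (?E n)"
    using K_subset_sgen[of "n - 1" n] Jstar_subset_sgen assms by (intro Un_mono) auto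
  also have "\<dots> \<subseteq> sgen pcomp ?G" by (simp add: sgen_mono)
  finally have gen: "sgen pcomp ?G = K n n"
    using sgen_subset_K[OF order_trans[OF G idempotents_K_subset]] by blast
  have least: "?G \<subseteq> A" if A: "A \<subseteq> K n n" "sgen pcomp A = K n n" for A
  proof -
    have sub: "A \<subseteq> LS n" using A(1) by (auto simp: K_def)
    have mem: "e \<in> sgen pcomp A" if "e \<in> ?G" for e
      using that G idempotents_K_subset A(2) by blast
    \<comment> \<open>Generators of rank \<open>n\<close> do occur here, but only as the identity,
      which is the exception allowed in \<open>idem_in_generators\<close>.\<close>
    have "card (ran x) \<le> n - 1 \<or> (x = pid {1..n} \<and> n - 1 < n)" if "x \<in> A" for x
      using A(1) KE that Jstar_top assms by (auto simp: K_def)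
    then have "?E (n - 1) \<subseteq> A"
      using mem idem_in_generators[OF _ sub, of _ "n - 1"] by blast
    moreover have "?E n \<subseteq> A"
      using mem idem_in_generators[OF _ sub, of _ n] card_ran_LS sub by blast
    ultimately show ?thesis by simp
  qed
  have "finite ?G" by (simp add: finite_idem)
  from rank_eq_card[OF G this gen least] show ?thesis by simp
qed

section \<open>Counting the idempotents of rank \<open>p\<close>\<close>

text \<open>An idempotent sends each point of its domain to the largest point of its image below it, so it
  is determined by its domain and its image.\<close>

lemma bij_betw_idem_dom_ran:
  assumes "1 \<le> p"
  shows "bij_betw (\<lambda>e. (dom e, ran e)) (idempotents pcomp (Jstar n p))
    (SIGMA D:{D. D \<subseteq> {1..n} \<and> p \<le> card D}. {F. F \<subseteq> D \<and> card F = p \<and> Min D \<in> F})"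
  (is "bij_betw ?\<phi> ?E ?S")
proof (rule bij_betw_imageI)
  show "inj_on ?\<phi> ?E"
  proof (rule inj_onI)
    fix e e' assume e: "e \<in> ?E" "e' \<in> ?E" "?\<phi> e = ?\<phi> e'"
    \<comment> \<open>The value \<open>y\<close> is in the common image, so \<open>e'\<close> fixes
      it; as \<open>y \<le> x\<close>, isotonicity of \<open>e'\<close> bounds \<open>y\<close> by
      \<open>y'\<close>. Exchanging the two maps gives equality.\<close>
    have le: "y \<le> y'" if "e \<in> ?E" "e' \<in> ?E" "ran e = ran e'" "e x = Some y" "e' x = Some y'"
      for e e' x y y'
    proof -
      have "y \<in> ran e'" using that by (metis ranI)
      then have "e' y = Some y" using that(2) by (auto simp: idem_Jstar_iff ran_def)
      moreover have "y \<le> x" using LS_le that(1,4) by (auto simp: idem_Jstar_iff)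
      ultimately show ?thesis using LS_mono that(2,5) by (auto simp: idem_Jstar_iff)
    qed
    show "e = e'"
    proof (rule ext)
      fix x
      show "e x = e' x"
      proof (cases "x \<in> dom e")
        case True
        then obtain y y' where y: "e x = Some y" "e' x = Some y'" using e(3) by (metis Pair_inject domD)
        then have "y = y'"
          using le[of e e' x y y'] le[of e' e x y' y] e by (intro antisym) auto
        then show ?thesis using y by simp
      next
        case False
        moreover have "x \<notin> dom e'" using False e(3) by simp
        ultimately show ?thesis by (metis domIff)
      qed
    qed
  qed
  show "?\<phi> ` ?E = ?S"
  proof (intro equalityI subsetI)
    fix s assume "s \<in> ?\<phi> ` ?E"
    then obtain e where e: "e \<in> ?E" "s = (dom e, ran e)" by auto
    then have LS: "e \<in> LS n" and card: "card (ran e) = p"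
      and idem: "\<And>x y. e x = Some y \<Longrightarrow> e y = Some y" by (auto simp: idem_Jstar_iff)
    have D: "dom e \<subseteq> {1..n}" using LS by (simp add: LS_def)
    then have fin: "finite (dom e)" by (rule finite_subset) simp
    have sub: "ran e \<subseteq> dom e" using idem by (auto simp: ran_def)
    have "ran e \<noteq> {}" using card assms by auto
    then have "dom e \<noteq> {}" using sub by blast
    then obtain y where y: "e (Min (dom e)) = Some y" using Min_in[OF fin] by blast
    \<comment> \<open>The image of an idempotent lies in its domain, so the least point of the
      domain cannot be moved down and must be fixed.\<close>
    then have "Min (dom e) \<le> y" using sub fin by (intro Min_le) (auto intro: ranI)
    then have "y = Min (dom e)" using LS_le[OF LS y] by simp
    then have "Min (dom e) \<in> ran e" using y by (metis ranI)
    then show "s \<in> ?S" using e(2) D sub card card_mono[OF fin sub] by simp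
  next
    fix s assume "s \<in> ?S"
    then obtain D F where s: "s = (D, F)" and D: "D \<subseteq> {1..n}" and F: "F \<subseteq> D" "card F = p" "Min D \<in> F"
      by auto
    have fin: "finite D" "finite F" using D F by (auto intro: finite_subset)
    define e where "e = (\<lambda>x. if x \<in> D then Some (Max {f \<in> F. f \<le> x}) else None)"
    have max: "Max {f \<in> F. f \<le> x} \<in> F \<and> Max {f \<in> F. f \<le> x} \<le> x" if "x \<in> D" for x
    proof -
      \<comment> \<open>This is where \<open>Min D \<in> F\<close> enters: it makes the set under
        \<open>Max\<close> nonempty for every \<open>x\<close> in \<open>D\<close>.\<close>
      have "Min D \<in> {f \<in> F. f \<le> x}" using F fin that by simp
      then have "Max {f \<in> F. f \<le> x} \<in> {f \<in> F. f \<le> x}" using fin by (intro Max_in) auto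
      then show ?thesis by simp
    qed
    have self: "Max {f \<in> F. f \<le> x} = x" if "x \<in> F" for x
      using that fin by (intro Max_eqI) auto
    have mono: "Max {f \<in> F. f \<le> x} \<le> Max {f \<in> F. f \<le> x'}" if "x \<in> D" "x \<le> x'" for x x'
      using max[OF that(1)] that(2) fin by (intro Max_ge) auto
    have dom: "dom e = D" by (auto simp: e_def dom_def)
    have ran: "ran e = F"
    proof (intro set_eqI iffI)
      fix y assume "y \<in> F"
      then have "e y = Some y" using F self by (auto simp: e_def)
      then show "y \<in> ran e" by (rule ranI)
    qed (auto simp: ran_def e_def max split: if_splits)
    have e_Some: "e x = Some y \<longleftrightarrow> x \<in> D \<and> y = Max {f \<in> F. f \<le> x}" for x y
      by (auto simp: e_def)
    have "e \<in> LS n"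
      unfolding LS_iff e_Some
    proof (intro conjI allI impI)
      fix x y assume xy: "x \<in> D \<and> y = Max {f \<in> F. f \<le> x}"
      then have "y \<in> F" "y \<le> x" using max by auto
      moreover have "x \<in> {1..n}" "y \<in> {1..n}" using xy \<open>y \<in> F\<close> D F by auto
      ultimately show "1 \<le> y" "y \<le> x" "x \<le> n" by auto
    qed (use mono in auto)
    then have "e \<in> ?E"
      using max self F by (auto simp: idem_Jstar_iff ran e_Some)
    then show "s \<in> ?\<phi> ` ?E" using s dom ran by auto
  qed
qed

lemma card_subsets_containing:
  assumes "finite D" "x \<in> D" "1 \<le> p"
  shows "card {F. F \<subseteq> D \<and> card F = p \<and> x \<in> F} = (card D - 1) choose (p - 1)"
proof -
  have fin: "finite F" if "F \<subseteq> D" for F using that assms(1) by (rule finite_subset)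
  have "bij_betw (insert x) {F. F \<subseteq> D - {x} \<and> card F = p - 1} {F. F \<subseteq> D \<and> card F = p \<and> x \<in> F}"
  proof (rule bij_betw_byWitness[where f' = "\<lambda>F. F - {x}"])
    show "insert x ` {F. F \<subseteq> D - {x} \<and> card F = p - 1} \<subseteq> {F. F \<subseteq> D \<and> card F = p \<and> x \<in> F}"
    proof clarify
      fix F assume F: "F \<subseteq> D - {x}" "card F = p - 1"
      then have "finite F" "x \<notin> F" using fin by auto
      then show "insert x F \<subseteq> D \<and> card (insert x F) = p \<and> x \<in> insert x F"
        using F assms by auto
    qed
  qed (use fin in auto)
  then have "card {F. F \<subseteq> D \<and> card F = p \<and> x \<in> F} = card {F. F \<subseteq> D - {x} \<and> card F = p - 1}"
    by (simp add: bij_betw_same_card)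
  also have "\<dots> = (card D - 1) choose (p - 1)"
    using n_subsets[of "D - {x}" "p - 1"] assms by simp
  finally show ?thesis .
qed

text \<open>The image must contain the least point of the domain, so a domain of size
  \<open>r\<close> leaves \<open>p - 1\<close> image points to choose from \<open>r - 1\<close>.
  Grouping the domains by size gives the sum.\<close>

lemma card_idem_Jstar:
  assumes "1 \<le> p"
  shows "card (idempotents pcomp (Jstar n p)) = (\<Sum>r=p..n. (n choose r) * ((r - 1) choose (p - 1)))"
proof -
  let ?D = "{D. D \<subseteq> {1..n} \<and> p \<le> card D}"
  have finD: "finite ?D" by (rule finite_subset[of _ "Pow {1..n}"]) auto
  have fin: "finite D" if "D \<in> ?D" for D using that by (auto intro: finite_subset)
  have "card (idempotents pcomp (Jstar n p)) =
      card (SIGMA D:?D. {F. F \<subseteq> D \<and> card F = p \<and> Min D \<in> F})"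
    using bij_betw_same_card[OF bij_betw_idem_dom_ran[OF assms]] .
  also have "\<dots> = (\<Sum>D\<in>?D. card {F. F \<subseteq> D \<and> card F = p \<and> Min D \<in> F})"
    by (rule card_SigmaI[OF finD]) (use fin in \<open>auto intro!: finite_subset[of _ "Pow _"]\<close>)
  also have "\<dots> = (\<Sum>D\<in>?D. (card D - 1) choose (p - 1))"
  proof (intro sum.cong refl card_subsets_containing assms)
    fix D assume D: "D \<in> ?D"
    then show "finite D" by (rule fin)
    then show "Min D \<in> D" using D assms by (intro Min_in) auto
  qed
  also have "\<dots> = (\<Sum>r=p..n. \<Sum>D\<in>{D \<in> ?D. card D = r}. (card D - 1) choose (p - 1))"
  proof (rule sum.group[symmetric])
    show "card ` ?D \<subseteq> {p..n}"
      using card_mono[of "{1..n}"] by fastforce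
  qed (use finD in auto)
  also have "\<dots> = (\<Sum>r=p..n. (n choose r) * ((r - 1) choose (p - 1)))"
  proof (rule sum.cong)
    fix r assume "r \<in> {p..n}"
    then have "{D \<in> ?D. card D = r} = {D. D \<subseteq> {1..n} \<and> card D = r}" by auto
    then show "(\<Sum>D\<in>{D \<in> ?D. card D = r}. (card D - 1) choose (p - 1)) =
        (n choose r) * ((r - 1) choose (p - 1))"
      using n_subsets[of "{1..n}" r] by simp
  qed simp
  finally show ?thesis .
qed

text \<open>The comparison with the number of idempotents of rank \<open>p\<close> is guarded by
  \<open>p < n\<close> because it fails at \<open>p = n\<close>, by \<open>srank_top_neq\<close>;
  the equality of the two ranks and the count hold there too.\<close>

theorem theorem3p9:
  fixes n p :: nat
  assumes "1 \<le> p" and "p \<le> n"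
  shows "srank pcomp (K n p) = idrank pcomp (K n p)
    \<and> (p < n \<longrightarrow> idrank pcomp (K n p) = enat (card (idempotents pcomp (Jstar n p))))
    \<and> card (idempotents pcomp (Jstar n p)) = (\<Sum>r=p..n. (n choose r) * ((r - 1) choose (p - 1)))"
proof (cases "p < n")
  case True
  then show ?thesis using rank_K_less card_idem_Jstar[OF assms(1)] by simp
next
  case False
  then have "p = n" using assms by simp
  then show ?thesis using srank_eq_idrank_top[of n] card_idem_Jstar[of n n] assms by simp
qed

end
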